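(* Let $m,n\geq 1$ be integers, and let $x_1,\ldots,x_{3m}$ be such that $x_{3k}=-1$ for all $1\leq k\leq m$, while the remaining $x_i$ ($3\nmid i$) are indeterminates. Then $$\sum_{0\le r_1,\ldots,r_{3m}\leq n}\ \prod_{k=1}^{3m}{n-r_k\brack r_{k+1}}q^{\binom{r_k}{2}}x_k^{r_k}=\frac{(x_1x_4\cdots x_{3m-2})^{n+1}-(x_2x_5\cdots x_{3m-1})^{n+1}}{x_1x_4\cdots x_{3m-2}-x_2x_5\cdots x_{3m-1}}\,q^{m\binom{n}{2}},$$ where the sum is over integers $r_1,\ldots,r_{3m}$ and $r_{3m+1}=r_1$.
   Context: Here $q$ is an indeterminate. The $q$-binomial coefficient is defined for integers $n,k$ by ${n\brack k}=\prod_{i=1}^{k}\frac{1-q^{n-i+1}}{1-q^i}$ if $0\leq k\leq n$, and ${n\brack k}=0$ otherwise. Also $\binom{r}{2}=r(r-1)/2$. The fraction $\frac{a^{n+1}-b^{n+1}}{a-b}$ is understood as the polynomial $\sum_{i=0}^n a^{i}b^{n-i}$, so the identity is a polynomial identity in the $x_i$ with $3\nmid i$ and may be specialized to arbitrary values of them. *)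

theory Defs
  imports
    "HOL-Computational_Algebra.Polynomial"
    "HOL-Computational_Algebra.Fraction_Field"
    "HOL-Library.Poly_Mapping"
    "HOL-Library.FuncSet"
begin

text \<open>The field \<open>K(q)\<close> of rational functions over an arbitrary field \<open>K\<close>.\<close>

type_synonym 'k ratfun = "'k poly fract"

definition q :: "'k::field ratfun" where
  "q = Fract [:0, 1:] 1"

definition qbinom :: "int \<Rightarrow> int \<Rightarrow> 'k::field ratfun" where
  "qbinom n k =
     (if 0 \<le> k \<and> k \<le> n
      then \<Prod>i=1..k. (1 - q powi (n - i + 1)) / (1 - q powi i)
      else 0)"

text \<open>The polynomial ring \<open>K(q)[x\<^sub>0, x\<^sub>1, x\<^sub>2, \<dots>]\<close>: finitely supported maps from monomials
  (finitely supported exponent vectors) to coefficients, with the convolution product.\<close>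

type_synonym 'k mpoly_q = "(nat \<Rightarrow>\<^sub>0 nat) \<Rightarrow>\<^sub>0 'k ratfun"

definition Const :: "'k::field ratfun \<Rightarrow> 'k mpoly_q" where
  "Const c = Poly_Mapping.single 0 c"

definition Var :: "nat \<Rightarrow> 'k::field mpoly_q" where
  "Var i = Poly_Mapping.single (Poly_Mapping.single i 1) 1"

end

theory Submission
  imports Defs
begin

text \<open>The left-hand side is the trace of a product of \<open>3m\<close> matrices
  \<open>A\<^sub>k(r, s) = [n - r, s] q\<^bsup>r(r-1)/2\<^esup> x\<^sub>k\<^sup>r\<close> with \<open>0 \<le> r, s \<le> n\<close>. By the \<open>q\<close>-Vandermonde type
  identity \<open>\<Sum>\<^sub>t (-1)\<^sup>t q\<^bsup>t(t-1)/2\<^esup> [N, t] [n - t, u] = q\<^bsup>N(n-u)\<^esup> [n - N, u - N]\<close>, the product of three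
  consecutive matrices with parameters \<open>a, b, -1\<close> is upper triangular with diagonal entries
  \<open>a\<^sup>r b\<^bsup>n-r\<^esup> q\<^bsup>n(n-1)/2\<^esup>\<close>. So the diagonal entries of the whole product are the products of these.\<close>

section \<open>Gaussian binomial coefficients\<close>

lemma q_power: "(q :: 'k::field ratfun) ^ i = Fract (monom 1 i) 1"
  by (induction i) (simp_all add: q_def One_fract_def monom_Suc)

text \<open>A positive power of the indeterminate is a nonconstant monomial. This keeps every
  denominator \<open>1 - q ^ i\<close> with \<open>0 < i\<close> nonzero.\<close>

lemma q_power_neq_1: "0 < i \<Longrightarrow> (q :: 'k::field ratfun) ^ i \<noteq> 1"
  by (simp add: q_power One_fract_def eq_fract monom_eq_1_iff)

text \<open>Truncated subtraction makes one product cover all natural arguments: if k > n, the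
  factor with index n has numerator \<open>1 - q ^ 0 = 0\<close>, in agreement with the default
  value 0.\<close>

lemma qbinom_nat:
  "qbinom (int n) (int k) = (\<Prod>i<k. (1 - q ^ (n - i)) / (1 - q ^ Suc i) :: 'k::field ratfun)"
proof (cases "k \<le> n")
  case True
  have "(\<Prod>i=1..int k. (1 - q powi (int n - i + 1)) / (1 - q powi i) :: 'k ratfun)
      = (\<Prod>i<k. (1 - q ^ (n - i)) / (1 - q ^ Suc i))"
  proof (rule prod.reindex_bij_witness[of _ "\<lambda>i. int i + 1" "\<lambda>i. nat (i - 1)"])
    fix i :: int assume i: "i \<in> {1..int k}"
    then obtain j where j: "i = int (Suc j)" "j < k"
      by (metis One_nat_def Suc_le_D atLeastAtMost_iff int_nat_eq int_one_le_iff_zero_less less_eq_Suc_le nat_int of_nat_0_less_iff order_less_le_trans zle_int zero_le_one order_trans)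
    have "int n - int (Suc j) + 1 = int (n - j)" using True j by simp
    then show "(1 - q ^ (n - nat (i - 1))) / (1 - q ^ Suc (nat (i - 1)))
        = (1 - q powi (int n - i + 1)) / (1 - q powi i :: 'k ratfun)"
      using j by (simp only: power_int_of_nat) simp
  qed auto
  then show ?thesis using True by (simp add: qbinom_def)
next
  case False
  then have "(\<Prod>i<k. (1 - q ^ (n - i)) / (1 - q ^ Suc i) :: 'k ratfun) = 0"
    by (intro prod_zero) (auto intro!: bexI[of _ n])
  then show ?thesis using False by (simp add: qbinom_def)
qed

lemma qbinom_0 [simp]: "0 \<le> n \<Longrightarrow> qbinom n 0 = 1"
  by (simp add: qbinom_def)

lemma qbinom_eq_0: "n < k \<Longrightarrow> qbinom (int n) (int k) = 0"
  by (simp add: qbinom_def)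

lemma qbinom_diag [simp]:
  assumes "0 \<le> n"
  shows "qbinom n n = (1 :: 'k::field ratfun)"
proof -
  obtain k where n: "n = int k" using assms nonneg_int_cases by blast
  \<comment> \<open>Reversing the order of the numerators gives exactly the denominators.\<close>
  have "(\<Prod>i<k. 1 - q ^ (k - i)) = (\<Prod>i<k. 1 - q ^ Suc i :: 'k ratfun)"
    by (rule prod.reindex_bij_witness[of _ "\<lambda>i. k - Suc i" "\<lambda>i. k - Suc i"])
      (auto simp: Suc_diff_Suc simp flip: power_Suc)
  then show ?thesis
    unfolding n qbinom_nat prod_dividef
    by (metis (no_types, lifting) divide_self prod_zero_iff finite_lessThan q_power_neq_1 right_minus_eq zero_less_Suc)
qed

text \<open>The two coefficients with lower entry k+1 are explicit multiples of \<open>g\<close>,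
  the coefficient [n, k], over the common denominator \<open>1 - q ^ Suc k\<close>. What remains is
  an identity between three numerators.\<close>

lemma qbinom_Pascal:
  assumes "k \<le> n"
  shows "qbinom (int (Suc n)) (int (Suc k))
    = (q ^ (n - k) * qbinom (int n) (int k) + qbinom (int n) (int (Suc k)) :: 'k::field ratfun)"
proof -
  define g where "g = (qbinom (int n) (int k) :: 'k ratfun)"
  have nz: "(1 - q ^ Suc i :: 'k ratfun) \<noteq> 0" for i
    using q_power_neq_1[of "Suc i"] by (metis right_minus_eq zero_less_Suc)
  have 1: "qbinom (int n) (int (Suc k)) = g * ((1 - q ^ (n - k)) / (1 - q ^ Suc k))"
    unfolding g_def qbinom_nat by simp
  have "(\<Prod>i<Suc k. 1 - q ^ (Suc n - i)) = (1 - q ^ Suc n) * (\<Prod>i<k. 1 - q ^ (n - i) :: 'k ratfun)"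
    by (subst prod.lessThan_Suc_shift) simp
  then have 2: "qbinom (int (Suc n)) (int (Suc k)) = g * ((1 - q ^ Suc n) / (1 - q ^ Suc k))"
    unfolding g_def qbinom_nat prod_dividef by (simp add: prod_dividef)
  have 3: "q ^ (n - k) * (1 - q ^ Suc k) + (1 - q ^ (n - k)) = (1 - q ^ Suc n :: 'k ratfun)"
    using assms by (simp add: algebra_simps flip: power_add power_Suc)
  have "q ^ (n - k) * g + g * ((1 - q ^ (n - k)) / (1 - q ^ Suc k))
      = g * ((q ^ (n - k) * (1 - q ^ Suc k) + (1 - q ^ (n - k))) / (1 - q ^ Suc k))"
    using nz[of k] by (simp only: add_divide_distrib distrib_left nonzero_mult_div_cancel_right not_False_eq_True mult.commute[of g])
  then show ?thesis unfolding 1 2 3 g_def by simp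
qed

text \<open>With E the shift F(t) -> F(t+1), the weighted sum is the value at 0 of (1 - E)(1 -
  qE)...(1 - q^(N-1) E) F, by the \<open>q\<close>-binomial theorem. The recursion applies the next
  factor 1 - q^N E.\<close>

lemma sum_qbinom_Suc:
  fixes F :: "nat \<Rightarrow> 'k::field ratfun"
  shows "(\<Sum>t\<le>Suc N. (-1) ^ t * q ^ (t choose 2) * qbinom (int (Suc N)) (int t) * F t)
    = (\<Sum>t\<le>N. (-1) ^ t * q ^ (t choose 2) * qbinom (int N) (int t) * F t)
      - q ^ N * (\<Sum>t\<le>N. (-1) ^ t * q ^ (t choose 2) * qbinom (int N) (int t) * F (Suc t))"
proof -
  let ?c = "\<lambda>t. (-1) ^ t * q ^ (t choose 2) :: 'k ratfun"
  \<comment> \<open>The power from Pascal's rule turns the weight of t+1 into that of t, up to the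
    factor -q^N, which is free of t and can leave the sum.\<close>
  have c: "?c (Suc t) * q ^ (N - t) = - (q ^ N * ?c t)" if "t \<le> N" for t
  proof -
    have "(Suc t choose 2) + (N - t) = N + (t choose 2)"
      using that by (simp add: numeral_2_eq_2)
    then have "q ^ (Suc t choose 2) * q ^ (N - t) = (q ^ N * q ^ (t choose 2) :: 'k ratfun)"
      by (simp flip: power_add)
    then show ?thesis by (simp add: mult.assoc mult.left_commute)
  qed
  have "(\<Sum>t\<le>Suc N. ?c t * qbinom (int (Suc N)) (int t) * F t)
      = F 0 + (\<Sum>t\<le>N. ?c (Suc t) * qbinom (int (Suc N)) (int (Suc t)) * F (Suc t))"
    by (subst sum.atMost_Suc_shift) (simp add: binomial_eq_0)
  also have "(\<Sum>t\<le>N. ?c (Suc t) * qbinom (int (Suc N)) (int (Suc t)) * F (Suc t))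
      = (\<Sum>t\<le>N. ?c (Suc t) * qbinom (int N) (int (Suc t)) * F (Suc t)
                 - q ^ N * (?c t * qbinom (int N) (int t) * F (Suc t)))"
  proof (rule sum.cong[OF refl])
    fix t assume "t \<in> {..N}"
    then have t: "t \<le> N" by simp
    have "?c (Suc t) * qbinom (int (Suc N)) (int (Suc t)) * F (Suc t)
        = (?c (Suc t) * q ^ (N - t)) * qbinom (int N) (int t) * F (Suc t)
          + ?c (Suc t) * qbinom (int N) (int (Suc t)) * F (Suc t)"
      unfolding qbinom_Pascal[OF t] by (simp only: distrib_left distrib_right mult.assoc)
    then show "?c (Suc t) * qbinom (int (Suc N)) (int (Suc t)) * F (Suc t)
        = ?c (Suc t) * qbinom (int N) (int (Suc t)) * F (Suc t)
          - q ^ N * (?c t * qbinom (int N) (int t) * F (Suc t))"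
      unfolding c[OF t] by (simp add: mult.assoc)
  qed
  also have "F 0 + \<dots> = (\<Sum>t\<le>Suc N. ?c t * qbinom (int N) (int t) * F t)
      - q ^ N * (\<Sum>t\<le>N. ?c t * qbinom (int N) (int t) * F (Suc t))"
    by (subst sum.atMost_Suc_shift) (simp add: sum_subtractf sum_distrib_left binomial_eq_0)
  \<comment> \<open>The top term vanishes, since [N, N+1] = 0.\<close>
  also have "(\<Sum>t\<le>Suc N. ?c t * qbinom (int N) (int t) * F t)
      = (\<Sum>t\<le>N. ?c t * qbinom (int N) (int t) * F t)"
    by (simp add: qbinom_def)
  finally show ?thesis .
qed

text \<open>For F(t) = [n - t, u] the shifted function is F with n - 1 in place of n. Both sums in
  the recursion are thus instances of the induction hypothesis, and Pascal's rule evaluates their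
  difference.\<close>

lemma alternating_sum_qbinom:
  assumes "N \<le> n"
  shows "(\<Sum>t\<le>N. (-1) ^ t * q ^ (t choose 2) * qbinom (int N) (int t) * qbinom (int (n - t)) (int u))
    = (if N \<le> u \<and> u \<le> n then q ^ (N * (n - u)) * qbinom (int (n - N)) (int (u - N)) else 0 :: 'k::field ratfun)"
  using assms
proof (induction N arbitrary: n)
  case 0
  then show ?case by (simp add: qbinom_eq_0 binomial_eq_0)
next
  case (Suc N)
  then obtain p where n: "n = Suc p" and "N \<le> p" by (cases n) auto
  have IH1: "(\<Sum>t\<le>N. (-1) ^ t * q ^ (t choose 2) * qbinom (int N) (int t) * qbinom (int (n - t)) (int u))
    = (if N \<le> u \<and> u \<le> n then q ^ (N * (n - u)) * qbinom (int (n - N)) (int (u - N)) else 0 :: 'k ratfun)"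
    using Suc by simp
  have IH2: "(\<Sum>t\<le>N. (-1) ^ t * q ^ (t choose 2) * qbinom (int N) (int t) * qbinom (int (p - t)) (int u))
    = (if N \<le> u \<and> u \<le> p then q ^ (N * (p - u)) * qbinom (int (p - N)) (int (u - N)) else 0 :: 'k ratfun)"
    using Suc.IH[OF \<open>N \<le> p\<close>] .
  \<comment> \<open>Only N < u < n needs Pascal's rule. For u = N the two terms cancel, for u = n
    the second is absent and the remaining coefficients are 1, and otherwise everything is
    0.\<close>
  consider "u < N" | "u = N" | "N < u" "u \<le> p" | "N < u" "u = n" | "n < u" using n by linarith
  then have "(if N \<le> u \<and> u \<le> n then q ^ (N * (n - u)) * qbinom (int (n - N)) (int (u - N)) else 0)
      - q ^ N * (if N \<le> u \<and> u \<le> p then q ^ (N * (p - u)) * qbinom (int (p - N)) (int (u - N)) else 0)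
    = (if Suc N \<le> u \<and> u \<le> n then q ^ (Suc N * (n - u)) * qbinom (int (n - Suc N)) (int (u - Suc N)) else 0 :: 'k ratfun)"
  proof cases
    case 2
    have "N * (n - u) = N + N * (p - u)" using n 2 \<open>N \<le> p\<close> by (simp add: Suc_diff_le)
    then show ?thesis using 2 n \<open>N \<le> p\<close> by (simp add: power_add)
  next
    case 3
    \<comment> \<open>This splits off the factor q^N needed to cancel the \<open>Y\<close> terms
      below.\<close>
    have e: "N * (n - u) = N + N * (p - u)" using n 3 by (simp add: Suc_diff_le)
    have d: "n - N = Suc (p - N)" "u - N = Suc (u - Suc N)" "n - u = p - N - (u - Suc N)"
      using n 3 by auto
    have pascal: "qbinom (int (n - N)) (int (u - N))
      = (q ^ (n - u) * qbinom (int (p - N)) (int (u - Suc N)) + qbinom (int (p - N)) (int (u - N)) :: 'k ratfun)"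
      unfolding d(3) unfolding d(1,2) by (rule qbinom_Pascal) (use 3 in simp)
    have "q ^ (N * (n - u)) * (q ^ (n - u) * Z + Y) - q ^ N * (q ^ (N * (p - u)) * Y)
      = q ^ (Suc N * (n - u)) * Z" for Y Z :: "'k ratfun"
      unfolding mult_Suc power_add unfolding e power_add by (simp add: algebra_simps)
    moreover have "N \<le> u \<and> u \<le> n" "N \<le> u \<and> u \<le> p" "Suc N \<le> u \<and> u \<le> n" "n - Suc N = p - N"
      using 3 n by auto
    ultimately show ?thesis by (simp only: pascal if_True simp_thms)
  next
    case 4
    then show ?thesis using 4 n by simp
  qed (use n in auto)
  then show ?case
    unfolding sum_qbinom_Suc IH1 using IH2 by (simp add: n)
qed

section \<open>Cyclic sums as traces\<close>

text \<open>Matrices of size n+1 are plain functions. Only the summation index is bounded, so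
  associativity is an unconditional equality of functions.\<close>

definition mat_mult :: "nat \<Rightarrow> (nat \<Rightarrow> nat \<Rightarrow> 'a::comm_semiring_1) \<Rightarrow> (nat \<Rightarrow> nat \<Rightarrow> 'a) \<Rightarrow> nat \<Rightarrow> nat \<Rightarrow> 'a"
  where "mat_mult n A B i j = (\<Sum>t\<le>n. A i t * B t j)"

fun mat_prod :: "nat \<Rightarrow> (nat \<Rightarrow> nat \<Rightarrow> nat \<Rightarrow> 'a::comm_semiring_1) \<Rightarrow> nat \<Rightarrow> nat \<Rightarrow> nat \<Rightarrow> 'a"
  where
    "mat_prod n A 0 = (\<lambda>i j. if i = j then 1 else 0)"
  | "mat_prod n A (Suc L) = mat_mult n (mat_prod n A L) (A (Suc L))"

lemma mat_mult_assoc: "mat_mult n (mat_mult n A B) C = mat_mult n A (mat_mult n B C)"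
proof (intro ext)
  show "mat_mult n (mat_mult n A B) C i j = mat_mult n A (mat_mult n B C) i j" for i j
    unfolding mat_mult_def sum_distrib_left sum_distrib_right
    by (subst sum.swap) (simp add: mult.assoc)
qed

lemma sum_PiE_Suc:
  fixes h :: "(nat \<Rightarrow> 'b) \<Rightarrow> 'a::comm_monoid_add"
  shows "(\<Sum>r \<in> {1..Suc L} \<rightarrow>\<^sub>E S. h r) = (\<Sum>r \<in> {1..L} \<rightarrow>\<^sub>E S. \<Sum>y\<in>S. h (r(Suc L := y)))"
proof -
  have ins: "{1..Suc L} = insert (Suc L) {1..L}" by auto
  have "(\<Sum>r \<in> {1..Suc L} \<rightarrow>\<^sub>E S. h r)
      = (\<Sum>(y, r) \<in> S \<times> ({1..L} \<rightarrow>\<^sub>E S). h (r(Suc L := y)))"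
    unfolding ins PiE_insert_eq
    by (subst sum.reindex[OF inj_combinator]) (auto simp: case_prod_unfold)
  also have "\<dots> = (\<Sum>y\<in>S. \<Sum>r \<in> {1..L} \<rightarrow>\<^sub>E S. h (r(Suc L := y)))"
    by (simp add: sum.cartesian_product)
  also have "\<dots> = (\<Sum>r \<in> {1..L} \<rightarrow>\<^sub>E S. \<Sum>y\<in>S. h (r(Suc L := y)))"
    by (rule sum.swap)
  finally show ?thesis .
qed

text \<open>An entry of the product sums the weights of all paths with given endpoints. The
  arbitrary endpoint weight \<open>g\<close> carries the induction: summing out the last vertex
  absorbs the last edge into a new \<open>g\<close>.\<close>

lemma sum_paths:
  fixes A :: "nat \<Rightarrow> nat \<Rightarrow> nat \<Rightarrow> 'a::comm_semiring_1"
  shows "(\<Sum>r \<in> {1..Suc L} \<rightarrow>\<^sub>E {0..n}. g (r 1) (r (Suc L)) * (\<Prod>k=1..L. A k (r k) (r (Suc k))))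
    = (\<Sum>i\<le>n. \<Sum>j\<le>n. g i j * mat_prod n A L i j)"
proof (induction L arbitrary: g)
  case 0
  show ?case unfolding sum_PiE_Suc
    by (simp add: if_distrib atLeast0AtMost cong: if_cong)
next
  case (Suc L)
  have "(\<Sum>r \<in> {1..Suc (Suc L)} \<rightarrow>\<^sub>E {0..n}. g (r 1) (r (Suc (Suc L))) * (\<Prod>k=1..Suc L. A k (r k) (r (Suc k))))
     = (\<Sum>r \<in> {1..Suc L} \<rightarrow>\<^sub>E {0..n}. (\<Sum>y\<le>n. g (r 1) y * A (Suc L) (r (Suc L)) y)
         * (\<Prod>k=1..L. A k (r k) (r (Suc k))))"
    unfolding sum_PiE_Suc[of _ "Suc L"] sum_distrib_right atLeast0AtMost
    by (intro sum.cong refl) (simp add: ac_simps)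
  also have "\<dots> = (\<Sum>i\<le>n. \<Sum>j\<le>n. (\<Sum>y\<le>n. g i y * A (Suc L) j y) * mat_prod n A L i j)"
    by (rule Suc.IH)
  also have "\<dots> = (\<Sum>i\<le>n. \<Sum>y\<le>n. g i y * mat_prod n A (Suc L) i y)"
    unfolding mat_prod.simps mat_mult_def sum_distrib_left sum_distrib_right
    by (rule sum.cong[OF refl], subst sum.swap) (simp add: ac_simps)
  finally show ?case .
qed

text \<open>Cut the cycle at the edge from the last vertex back to the first; the weight of this
  edge serves as the endpoint weight of the remaining path.\<close>

lemma cyclic_sum_eq_trace:
  fixes A :: "nat \<Rightarrow> nat \<Rightarrow> nat \<Rightarrow> 'a::comm_semiring_1"
  assumes "0 < L"
  shows "(\<Sum>r \<in> {1..L} \<rightarrow>\<^sub>E {0..n}. \<Prod>k=1..L. A k (r k) (r (if k = L then 1 else k + 1)))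
    = (\<Sum>i\<le>n. mat_prod n A L i i)"
proof -
  obtain l where L: "L = Suc l" using assms by (cases L) auto
  have "(\<Prod>k=1..L. A k (r k) (r (if k = L then 1 else k + 1)))
      = A (Suc l) (r (Suc l)) (r 1) * (\<Prod>k=1..l. A k (r k) (r (Suc k)))" for r
    by (simp add: L mult.commute)
  then have "(\<Sum>r \<in> {1..L} \<rightarrow>\<^sub>E {0..n}. \<Prod>k=1..L. A k (r k) (r (if k = L then 1 else k + 1)))
      = (\<Sum>r \<in> {1..Suc l} \<rightarrow>\<^sub>E {0..n}. A (Suc l) (r (Suc l)) (r 1) * (\<Prod>k=1..l. A k (r k) (r (Suc k))))"
    by (simp add: L)
  also have "\<dots> = (\<Sum>i\<le>n. \<Sum>j\<le>n. A (Suc l) j i * mat_prod n A l i j)"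
    by (rule sum_paths[of "\<lambda>i j. A (Suc l) j i"])
  finally show ?thesis by (simp add: L mat_mult_def mult.commute)
qed

lemma mat_mult_triangular:
  assumes "\<And>i j. \<lbrakk>i \<le> n; j < i\<rbrakk> \<Longrightarrow> A i j = 0"
    and "\<And>i j. \<lbrakk>i \<le> n; j < i\<rbrakk> \<Longrightarrow> B i j = 0"
    and "i \<le> n"
  shows "j < i \<Longrightarrow> mat_mult n A B i j = 0"
    and "mat_mult n A B i i = A i i * B i i"
proof -
  show "mat_mult n A B i j = 0" if "j < i"
    unfolding mat_mult_def
  proof (intro sum.neutral ballI)
    fix t assume "t \<in> {..n}"
    then show "A i t * B t j = 0" using assms that by (cases "t < i") auto
  qed
  have "A i t * B t i = 0" if "t \<le> n" "t \<noteq> i" for t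
    using assms that by (cases "t < i") auto
  then have "mat_mult n A B i i = (\<Sum>t\<in>{i}. A i t * B t i)"
    unfolding mat_mult_def by (intro sum.mono_neutral_right) (use assms in auto)
  then show "mat_mult n A B i i = A i i * B i i" by simp
qed

section \<open>Three consecutive factors\<close>

lemma Const_mult: "Const (a * b) = Const a * Const b"
  by (simp add: Const_def mult_single)

lemma Const_1: "Const 1 = 1"
  by (simp add: Const_def)

lemma Const_0: "Const 0 = 0"
  by (simp add: Const_def)

lemma Const_sum: "Const (sum f S) = (\<Sum>i\<in>S. Const (f i))"
  by (induction S rule: infinite_finite_induct) (simp_all add: Const_0, simp add: Const_def single_add)

lemma Const_power: "Const (a ^ k) = Const a ^ k"
  by (induction k) (simp_all add: Const_1 Const_mult)

lemma Const_minus_1: "Const (- 1) = - 1"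
  by (simp add: Const_def single_uminus)

definition step_mat :: "nat \<Rightarrow> 'k::field mpoly_q \<Rightarrow> nat \<Rightarrow> nat \<Rightarrow> 'k mpoly_q" where
  "step_mat n a r s = Const (qbinom (int n - int r) (int s) * q ^ (r choose 2)) * a ^ r"

text \<open>The parameter -1 supplies the signs of the alternating sum, which is then evaluated with
  N = n - s.\<close>

lemma step_mat_mult_minus_1:
  assumes "s \<le> n"
  shows "mat_mult n (step_mat n b) (step_mat n (- 1)) s u
    = Const (q ^ (s choose 2) *
        (if n \<le> s + u \<and> u \<le> n then q ^ ((n - s) * (n - u)) * qbinom (int s) (int (s + u - n)) else 0)) * b ^ s"
    (is "_ = Const (_ * ?R) * _")
proof -
  let ?f = "\<lambda>t. (-1) ^ t * q ^ (t choose 2) * qbinom (int (n - s)) (int t) * qbinom (int (n - t)) (int u) :: 'a ratfun"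
  have "step_mat n b s t * step_mat n (- 1) t u = Const (q ^ (s choose 2) * ?f t) * b ^ s"
    if "t \<le> n" for t
    using assms that
    by (simp add: step_mat_def Const_mult Const_power Const_minus_1 of_nat_diff ac_simps)
  then have "mat_mult n (step_mat n b) (step_mat n (- 1)) s u
      = Const (q ^ (s choose 2) * (\<Sum>t\<le>n. ?f t)) * b ^ s"
    by (simp add: mat_mult_def Const_sum sum_distrib_left sum_distrib_right)
  \<comment> \<open>The coefficient [n - s, t] vanishes for t > n - s.\<close>
  also have "(\<Sum>t\<le>n. ?f t) = (\<Sum>t\<le>n - s. ?f t)"
    by (intro sum.mono_neutral_right) (auto simp: qbinom_eq_0)
  also have "\<dots> = ?R"
    using assms by (subst alternating_sum_qbinom) (auto simp: Let_def not_le intro!: arg_cong2[of _ _ _ _ "(*)"] arg_cong2[of _ _ _ _ qbinom])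
  finally show ?thesis .
qed

text \<open>Pairs from n points lie inside an r-subset, inside its complement, or across the
  two.\<close>

lemma choose_two_split:
  assumes "r \<le> n"
  shows "(r choose 2) + (n - r choose 2) + r * (n - r) = n choose 2"
proof -
  obtain s where n: "n = r + s" using assms le_Suc_ex by blast
  have "(r choose 2) + (s choose 2) + r * s = r + s choose 2"
    by (induction r) (simp_all add: numeral_2_eq_2)
  then show ?thesis by (simp add: n)
qed

text \<open>Row r of the first factor vanishes at s > n - r, and column u of the product of the
  other two vanishes at s < n - u. So no s survives if u < r, and only s = n - r if u = r.\<close>

lemma triple_triangular:
  assumes "r \<le> n"
  defines "T \<equiv> \<lambda>a b. mat_mult n (step_mat n a) (mat_mult n (step_mat n b) (step_mat n (- 1)))"
  shows "u < r \<Longrightarrow> T a b r u = 0"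
    and "T a b r r = a ^ r * b ^ (n - r) * Const (q ^ (n choose 2))"
proof -
  let ?B = "mat_mult n (step_mat n b) (step_mat n (- 1))"
  have sup: "step_mat n a r s = 0" if "n - r < s" for s
    using that by (simp add: step_mat_def qbinom_def Const_0)
  have low: "?B s v = 0" if "s \<le> n" "s < n - v" for s v
    proof -
    have "\<not> n \<le> s + v" using that by simp
    then show ?thesis using that by (simp add: step_mat_mult_minus_1 Const_0)
  qed
  show "T a b r u = 0" if "u < r"
    unfolding T_def mat_mult_def[of n "step_mat n a"]
  proof (intro sum.neutral ballI)
    fix s assume "s \<in> {..n}"
    then show "step_mat n a r s * ?B s u = 0"
      using sup[of s] low[of s u] that assms by (cases "n - r < s") auto
  qed
  have "step_mat n a r s * ?B s r = 0" if "s \<le> n" "s \<noteq> n - r" for s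
    using sup[of s] low[of s r] that by (cases "n - r < s") auto
  then have "T a b r r = (\<Sum>s\<in>{n - r}. step_mat n a r s * ?B s r)"
    unfolding T_def mat_mult_def[of n "step_mat n a"] by (intro sum.mono_neutral_right) auto
  \<comment> \<open>At s = n - r and u = r both \<open>q\<close>-binomials, [n - r, n - r] and
    [n - r, 0], equal 1.\<close>
  also have "\<dots> = a ^ r * b ^ (n - r) * Const (q ^ (r choose 2) * q ^ (n - r choose 2) * q ^ (r * (n - r)))"
    using assms
    by (simp add: step_mat_mult_minus_1) (simp add: step_mat_def of_nat_diff Const_mult ac_simps)
  also have "\<dots> = a ^ r * b ^ (n - r) * Const (q ^ (n choose 2))"
    using choose_two_split[OF assms(1)] by (simp flip: power_add)
  finally show "T a b r r = a ^ r * b ^ (n - r) * Const (q ^ (n choose 2))" .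
qed

text \<open>Each induction step multiplies by one more triple. Triangularity is carried along
  because diagonal entries are multiplicative only for triangular factors.\<close>

lemma mat_prod_step_mat:
  assumes "\<And>k. k \<in> {1..m} \<Longrightarrow> x (3 * k) = - 1" "i \<le> n"
  shows "(j < i \<longrightarrow> mat_prod n (\<lambda>k. step_mat n (x k)) (3 * m) i j = 0)
    \<and> mat_prod n (\<lambda>k. step_mat n (x k)) (3 * m) i i
      = (\<Prod>k=1..m. x (3 * k - 2)) ^ i * (\<Prod>k=1..m. x (3 * k - 1)) ^ (n - i)
        * Const (q ^ (m * (n choose 2)))"
  using assms
proof (induction m arbitrary: i j)
  case (Suc m)
  let ?P = "mat_prod n (\<lambda>k. step_mat n (x k)) (3 * m)"
  let ?T = "mat_mult n (step_mat n (x (3 * Suc m - 2)))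
              (mat_mult n (step_mat n (x (3 * Suc m - 1))) (step_mat n (- 1)))"
  have x: "x (3 * Suc m) = - 1" and x': "\<And>k. k \<in> {1..m} \<Longrightarrow> x (3 * k) = - 1"
    using Suc.prems(1)[of "Suc m"] Suc.prems(1) by auto
  \<comment> \<open>Writing the length with three successors lets the recursion peel off three
    factors, which associativity groups into a triple.\<close>
  have "mat_prod n (\<lambda>k. step_mat n (x k)) (3 * Suc m)
      = mat_prod n (\<lambda>k. step_mat n (x k)) (Suc (Suc (Suc (3 * m))))"
    by (rule arg_cong[of _ _ "mat_prod n _"]) simp
  also have "\<dots> = mat_mult n ?P (mat_mult n (step_mat n (x (Suc (3 * m))))
      (mat_mult n (step_mat n (x (Suc (Suc (3 * m))))) (step_mat n (x (Suc (Suc (Suc (3 * m))))))))"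
    by (simp only: mat_prod.simps mat_mult_assoc)
  also have "\<dots> = mat_mult n ?P ?T"
    using x by (simp add: numeral_3_eq_3)
  finally have step: "mat_prod n (\<lambda>k. step_mat n (x k)) (3 * Suc m) = mat_mult n ?P ?T" .
  have P: "?P i j = 0" if "i \<le> n" "j < i" for i j
    using Suc.IH[OF x' \<open>i \<le> n\<close>, of j] that by blast
  have T: "?T i j = 0" if "i \<le> n" "j < i" for i j
    using triple_triangular(1)[OF that] .
  have "mat_mult n ?P ?T i j = 0" if "j < i"
    by (rule mat_mult_triangular(1)) (fact P T Suc.prems that)+
  moreover have "mat_mult n ?P ?T i i = ?P i i * ?T i i"
    by (rule mat_mult_triangular(2)) (fact P T Suc.prems)+
  moreover have "?P i i = (\<Prod>k=1..m. x (3 * k - 2)) ^ i * (\<Prod>k=1..m. x (3 * k - 1)) ^ (n - i)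
        * Const (q ^ (m * (n choose 2)))"
    using Suc.IH[OF x' Suc.prems(2)] by blast
  moreover have "?T i i = x (3 * Suc m - 2) ^ i * x (3 * Suc m - 1) ^ (n - i) * Const (q ^ (n choose 2))"
    by (rule triple_triangular(2)) (fact Suc.prems)
  ultimately show ?case
    unfolding step by (simp add: power_mult_distrib power_add Const_mult ac_simps del: mult_Suc_right)
qed (auto simp: Const_1)

theorem theorem2p2:
  fixes m n :: nat
    and x :: "nat \<Rightarrow> 'k::field mpoly_q"
  assumes "m \<ge> 1" and "n \<ge> 1"
    and "\<And>k. k \<in> {1..m} \<Longrightarrow> x (3 * k) = - 1"
    and "\<And>i. i \<in> {1..3 * m} \<Longrightarrow> \<not> 3 dvd i \<Longrightarrow> x i = Var i"
  shows "(\<Sum>r \<in> {1..3 * m} \<rightarrow>\<^sub>E {0..n}.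
            \<Prod>k=1..3 * m.
              Const (qbinom (int n - int (r k)) (int (r (if k = 3 * m then 1 else k + 1)))
                     * q ^ (r k choose 2))
              * x k ^ r k)
       = (\<Sum>i=0..n. (\<Prod>k=1..m. x (3 * k - 2)) ^ i * (\<Prod>k=1..m. x (3 * k - 1)) ^ (n - i))
         * Const (q ^ (m * (n choose 2)))"
proof -
  have "(\<Sum>r \<in> {1..3 * m} \<rightarrow>\<^sub>E {0..n}.
            \<Prod>k=1..3 * m. step_mat n (x k) (r k) (r (if k = 3 * m then 1 else k + 1)))
      = (\<Sum>i\<le>n. mat_prod n (\<lambda>k. step_mat n (x k)) (3 * m) i i)"
    by (rule cyclic_sum_eq_trace) (use assms(1) in simp)
  \<comment> \<open>The trace needs only the diagonal entries, which are the terms of the polynomial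
    form of the quotient, each times the common power of \<open>q\<close>.\<close>
  also have "\<dots> = (\<Sum>i\<le>n. (\<Prod>k=1..m. x (3 * k - 2)) ^ i * (\<Prod>k=1..m. x (3 * k - 1)) ^ (n - i)
      * Const (q ^ (m * (n choose 2))))"
    by (intro sum.cong refl mat_prod_step_mat[THEN conjunct2] assms(3)) auto
  finally show ?thesis
    unfolding step_mat_def atLeast0AtMost sum_distrib_right .
qed

end
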